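(* Let $\alpha,\beta,\gamma,\delta$ be positive real numbers and let $V$ be the infinite-dimensional complex vector space with basis $e_n$, $n=0,1,2,\ldots$, endowed with the actions $$A_1\,e_{n}=(-1)^{n}(n+2\alpha+2\gamma+3/2)\,e_{n},\qquad A_2\,e_{n}=\sqrt{u_{n+1}}\,e_{n+1}+c_{n}\,e_{n}+\sqrt{u_{n}}\,e_{n-1}$$ (with $e_{-1}=0$), where $$c_{n}=\begin{cases}2\beta-\dfrac{(n+4\alpha+2)(\beta-\delta)}{n+2\alpha+2\gamma+2}-\dfrac{n(\beta+\delta)}{n+2\alpha+2\gamma+1} & n\text{ even}\\[2ex] 2\beta-\dfrac{(n+4\alpha+4\gamma+3)(\beta+\delta)}{n+2\alpha+2\gamma+2}-\dfrac{(n+4\gamma+1)(\beta-\delta)}{n+2\alpha+2\gamma+1} & n\text{ odd}\end{cases}$$ $$u_{n}=\begin{cases}\dfrac{n(n+4\alpha+4\gamma+2)\,\left|n+2[\alpha+\gamma+i(\beta+\delta)]+1\right|^2}{4(n+2\alpha+2\gamma+1)^2} & n\text{ even}\\[2ex] \dfrac{(n+4\alpha+1)(n+4\gamma+1)\,\left|n+2[\alpha+\gamma+i(\beta-\delta)]+1\right|^2}{4(n+2\alpha+2\gamma+1)^2} & n\text{ odd}\end{cases}$$ Then $V$ supports an infinite-dimensional, irreducible, self-adjoint representation of the non-compact Bannai--Ito algebra whose structure constants $\alpha_1,\alpha_2,\alpha_3$ are those attached to $\mathfrak{a}=\alpha+i\beta$, $\mathfrak{b}=\gamma+i\delta$, $\mathfrak{c}=\alpha-i\beta$,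 $\mathfrak{d}=\gamma-i\delta$.
   Context: Write $\{A,B\}=AB+BA$. The non-compact Bannai--Ito algebra with structure constants $\alpha_1,\alpha_2,\alpha_3$ has generators $A_1,A_2,A_3$ and relations $$\{A_1,A_2\}=A_3+\alpha_3,\qquad \{A_2,A_3\}=-A_1+\alpha_1,\qquad \{A_3,A_1\}=A_2+\alpha_2,$$ the first relation being taken as the definition of $A_3$ (so in a representation $A_3$ acts as $\{A_1,A_2\}-\alpha_3$). The structure constants attached to parameters $\mathfrak{a},\mathfrak{b},\mathfrak{c},\mathfrak{d}$ are $$\alpha_1=-[4(\mathfrak{a}\mathfrak{b}+\mathfrak{c}\mathfrak{d})+\mathfrak{a}+\mathfrak{b}+\mathfrak{c}+\mathfrak{d}+1/2],$$ $$\alpha_2=-i[2(\mathfrak{a}^2+\mathfrak{b}^2-\mathfrak{c}^2-\mathfrak{d}^2)+\mathfrak{a}+\mathfrak{b}-\mathfrak{c}-\mathfrak{d}],$$ $$\alpha_3=-i[4(\mathfrak{a}\mathfrak{b}-\mathfrak{c}\mathfrak{d})+\mathfrak{a}+\mathfrak{b}-\mathfrak{c}-\mathfrak{d}].$$ (The scalars $\alpha_1,\alpha_2,\alpha_3$ are not to be confused with the real parameter $\alpha$.) A representation on $V$ is self-adjoint if $A_j^{\dagger}=A_j$ for $j=1,2,3$, i.e. $\langle A_jv,w\rangle=\langle v,A_jw\rangle$ for all $v,w\in V$, with respect to the inner product for which $(e_n)_{n\ge0}$ is orthonormal. It is irreducible if $V$ has no invariant subspaces other than $0$ and $V$. Here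 $V$ is the space of finite linear combinations of the $e_n$. *)

theory Defs
  imports Complex_Main
begin

definition anticommutator :: "('v::plus \<Rightarrow> 'v) \<Rightarrow> ('v \<Rightarrow> 'v) \<Rightarrow> 'v \<Rightarrow> 'v" where
  "anticommutator A B v = A (B v) + B (A v)"

(* A representation of the algebra given by generators and relations is a triple of
   linear operators satisfying the relations; a scalar s stands for s times the identity. *)
locale noncompact_bannai_ito_rep = vector_space scale
  for scale :: "complex \<Rightarrow> 'v::ab_group_add \<Rightarrow> 'v"
    and s1 s2 s3 :: complex
    and A1 A2 A3 :: "'v \<Rightarrow> 'v" +
  assumes linear_A1: "Vector_Spaces.linear scale scale A1"
    and linear_A2: "Vector_Spaces.linear scale scale A2"
    and linear_A3: "Vector_Spaces.linear scale scale A3"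
    and rel12: "anticommutator A1 A2 v = A3 v + scale s3 v"
    and rel23: "anticommutator A2 A3 v = - A1 v + scale s1 v"
    and rel31: "anticommutator A3 A1 v = A2 v + scale s2 v"

definition struct1 :: "complex \<Rightarrow> complex \<Rightarrow> complex \<Rightarrow> complex \<Rightarrow> complex" where
  "struct1 a b c d = - (4 * (a * b + c * d) + a + b + c + d + 1 / 2)"

definition struct2 :: "complex \<Rightarrow> complex \<Rightarrow> complex \<Rightarrow> complex \<Rightarrow> complex" where
  "struct2 a b c d = - \<i> * (2 * (a\<^sup>2 + b\<^sup>2 - c\<^sup>2 - d\<^sup>2) + a + b - c - d)"

definition struct3 :: "complex \<Rightarrow> complex \<Rightarrow> complex \<Rightarrow> complex \<Rightarrow> complex" where
  "struct3 a b c d = - \<i> * (4 * (a * b - c * d) + a + b - c - d)"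

definition is_sequence_basis ::
  "(complex \<Rightarrow> 'v::ab_group_add \<Rightarrow> 'v) \<Rightarrow> (nat \<Rightarrow> 'v) \<Rightarrow> bool" where
  "is_sequence_basis scale e \<longleftrightarrow>
     inj e \<and> \<not> module.dependent scale (range e) \<and> module.span scale (range e) = UNIV"

definition infinite_dimensional :: "(complex \<Rightarrow> 'v::ab_group_add \<Rightarrow> 'v) \<Rightarrow> bool" where
  "infinite_dimensional scale \<longleftrightarrow> \<not> (\<exists>B. finite B \<and> module.span scale B = UNIV)"

(* Complex inner products, linear in the first argument; together with conjugate
   symmetry this gives conjugate linearity in the second. *)
locale hermitian_inner_product = vector_space scale
  for scale :: "complex \<Rightarrow> 'v::ab_group_add \<Rightarrow> 'v"
    and ip :: "'v \<Rightarrow> 'v \<Rightarrow> complex" +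
  assumes ip_add_left: "ip (x + y) z = ip x z + ip y z"
    and ip_scale_left: "ip (scale r x) z = r * ip x z"
    and ip_cnj: "ip x y = cnj (ip y x)"
    and ip_pos: "x \<noteq> 0 \<Longrightarrow> Re (ip x x) > 0"

definition orthonormal :: "('v \<Rightarrow> 'v \<Rightarrow> complex) \<Rightarrow> (nat \<Rightarrow> 'v) \<Rightarrow> bool" where
  "orthonormal ip e \<longleftrightarrow> (\<forall>m n. ip (e m) (e n) = (if m = n then 1 else 0))"

definition self_adjoint :: "('v \<Rightarrow> 'v \<Rightarrow> complex) \<Rightarrow> ('v \<Rightarrow> 'v) \<Rightarrow> bool" where
  "self_adjoint ip A \<longleftrightarrow> (\<forall>v w. ip (A v) w = ip v (A w))"

definition invariant_under :: "('v \<Rightarrow> 'v) \<Rightarrow> 'v set \<Rightarrow> bool" where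
  "invariant_under A W \<longleftrightarrow> (\<forall>w\<in>W. A w \<in> W)"

definition irreducible_rep ::
  "(complex \<Rightarrow> 'v::ab_group_add \<Rightarrow> 'v) \<Rightarrow> ('v \<Rightarrow> 'v) \<Rightarrow> ('v \<Rightarrow> 'v) \<Rightarrow> ('v \<Rightarrow> 'v) \<Rightarrow> bool" where
  "irreducible_rep scale A1 A2 A3 \<longleftrightarrow>
     (\<forall>W. module.subspace scale W \<and> invariant_under A1 W \<and> invariant_under A2 W \<and>
          invariant_under A3 W \<longrightarrow> W = {0} \<or> W = UNIV)"

definition coeff_c :: "real \<Rightarrow> real \<Rightarrow> real \<Rightarrow> real \<Rightarrow> nat \<Rightarrow> real" where
  "coeff_c \<alpha> \<beta> \<gamma> \<delta> n =
     (if even n then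
        2 * \<beta>
        - (real n + 4 * \<alpha> + 2) * (\<beta> - \<delta>) / (real n + 2 * \<alpha> + 2 * \<gamma> + 2)
        - real n * (\<beta> + \<delta>) / (real n + 2 * \<alpha> + 2 * \<gamma> + 1)
      else
        2 * \<beta>
        - (real n + 4 * \<alpha> + 4 * \<gamma> + 3) * (\<beta> + \<delta>) / (real n + 2 * \<alpha> + 2 * \<gamma> + 2)
        - (real n + 4 * \<gamma> + 1) * (\<beta> - \<delta>) / (real n + 2 * \<alpha> + 2 * \<gamma> + 1))"

definition coeff_u :: "real \<Rightarrow> real \<Rightarrow> real \<Rightarrow> real \<Rightarrow> nat \<Rightarrow> real" where
  "coeff_u \<alpha> \<beta> \<gamma> \<delta> n =
     (if even n then
        real n * (real n + 4 * \<alpha> + 4 * \<gamma> + 2)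
        * (cmod (of_nat n + 2 * (of_real (\<alpha> + \<gamma>) + \<i> * of_real (\<beta> + \<delta>)) + 1))\<^sup>2
        / (4 * (real n + 2 * \<alpha> + 2 * \<gamma> + 1)\<^sup>2)
      else
        (real n + 4 * \<alpha> + 1) * (real n + 4 * \<gamma> + 1)
        * (cmod (of_nat n + 2 * (of_real (\<alpha> + \<gamma>) + \<i> * of_real (\<beta> - \<delta>)) + 1))\<^sup>2
        / (4 * (real n + 2 * \<alpha> + 2 * \<gamma> + 1)\<^sup>2))"

end

theory Submission
  imports Defs
begin

text \<open>
  In the basis \<open>e\<close> the operator \<open>A\<^sub>1\<close> is diagonal with eigenvalues \<open>\<lambda>\<^sub>n\<close> satisfying
  \<open>\<lambda>\<^sub>n + \<lambda>\<^sub>n\<^sub>+\<^sub>1 = (-1)\<^sup>n\<^sup>+\<^sup>1\<close>, so \<open>A\<^sub>3\<close> is again tridiagonal: its off-diagonal entries are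
  those of \<open>A\<^sub>2\<close> up to sign, and its diagonal entries are \<open>d\<^sub>n = 2\<lambda>\<^sub>nc\<^sub>n - \<alpha>\<^sub>3\<close>. Comparing matrix
  entries, the relations reduce to three rational identities in \<open>c\<^sub>n\<close> and \<open>u\<^sub>n\<close>. These become
  transparent in the variable \<open>x = n + 2\<alpha> + 2\<gamma> + 1\<close>, in which
  \<open>c\<^sub>n = (\<alpha>\<^sub>2 + 2\<lambda>\<^sub>n\<alpha>\<^sub>3) / (4\<lambda>\<^sub>n\<^sup>2 - 1)\<close> and
  \<open>4u\<^sub>n = x\<^sup>2 + K\<^sub>n - ((\<alpha>\<^sub>2 + (-1)\<^sup>n\<alpha>\<^sub>3) / (2x))\<^sup>2\<close> with \<open>K\<^sub>n\<close> depending only on the parity of \<open>n\<close>.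
  Irreducibility holds because the \<open>\<lambda>\<^sub>n\<close> are distinct, so an invariant subspace contains
  some \<open>e\<^sub>n\<close> as soon as it is nonzero, and because no off-diagonal entry of \<open>A\<^sub>2\<close> vanishes.
\<close>

section \<open>Linear algebra of eigenvectors and tridiagonal operators\<close>

text \<open>Induction on \<open>S\<close>: \<open>T - l j\<close> kills \<open>x j\<close> and
  scales every other component by the nonzero \<open>l k - l j\<close>, leaving eigenvectors to
  which the induction hypothesis applies.\<close>

lemma (in vector_space) eigencomponents_mem_invariant_subspace:
  assumes lin: "Vector_Spaces.linear scale scale T"
    and sub: "subspace W" and inv: "invariant_under T W"
    and "finite S" "inj_on l S" "\<And>k. k \<in> S \<Longrightarrow> T (x k) = scale (l k) (x k)"
    and "sum x S \<in> W" and "k \<in> S"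
  shows "x k \<in> W"
  using assms(4-)
proof (induction S arbitrary: x k rule: finite_induct)
  case empty
  then show ?case by simp
next
  case (insert j S)
  interpret T: Vector_Spaces.linear scale scale T by (rule lin)
  let ?y = "sum x (insert j S)"
  have y: "?y \<in> W" using insert.prems by blast
  have "T ?y - scale (l j) ?y = (\<Sum>k\<in>insert j S. T (x k) - scale (l j) (x k))"
    by (simp add: T.sum scale_sum_right sum_subtractf)
  also have "\<dots> = (\<Sum>k\<in>insert j S. scale (l k - l j) (x k))"
    by (rule sum.cong) (simp_all add: insert.prems(2) scale_left_diff_distrib)
  also have "\<dots> = (\<Sum>k\<in>S. scale (l k - l j) (x k))"
    using insert.hyps by simp
  finally have "(\<Sum>k\<in>S. scale (l k - l j) (x k)) \<in> W"
    using y inv sub unfolding invariant_under_def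
    by (metis subspace_diff subspace_scale)
  moreover have "T (scale (l k - l j) (x k)) = scale (l k) (scale (l k - l j) (x k))" if "k \<in> S" for k
    using that insert.prems(2)[of k] by (simp add: T.scale mult.commute)
  ultimately have scaled: "scale (l k - l j) (x k) \<in> W" if "k \<in> S" for k
    using insert.IH[of "\<lambda>k. scale (l k - l j) (x k)"] insert.prems(1) that by auto
  have S: "x k \<in> W" if "k \<in> S" for k
  proof -
    have "l k - l j \<noteq> 0"
      using that insert.hyps insert.prems(1) by (auto simp: inj_on_def)
    then have "x k = scale (inverse (l k - l j)) (scale (l k - l j) (x k))" by simp
    then show ?thesis using scaled[OF that] sub subspace_scale by metis
  qed
  have "x j = ?y - sum x S" using insert.hyps by simp
  moreover have "sum x S \<in> W" using S sub by (simp add: subspace_sum)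
  ultimately have "x j \<in> W" using y sub subspace_diff by metis
  then show ?case using S insert.prems by blast
qed

text \<open>The truncated indices \<open>n - 1\<close> and \<open>n - 2\<close> are harmless, since their coefficients carry
  the factor \<open>p 0 = 0\<close> or \<open>q 0 = 0\<close> whenever truncation occurs.\<close>
lemma (in vector_space) anticommutator_tridiagonal:
  fixes e :: "nat \<Rightarrow> 'b"
  assumes linA: "Vector_Spaces.linear scale scale A"
    and linB: "Vector_Spaces.linear scale scale B"
    and A: "\<And>n. A (e n) = scale (p (n + 1)) (e (n + 1)) + scale (c n) (e n) + scale (p n) (e (n - 1))"
    and B: "\<And>n. B (e n) = scale (q (n + 1)) (e (n + 1)) + scale (d n) (e n) + scale (q n) (e (n - 1))"
    and p0: "p 0 = 0" and q0: "q 0 = 0"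
  shows "anticommutator A B (e n) =
      scale (p (n + 2) * q (n + 1) + q (n + 2) * p (n + 1)) (e (n + 2))
      + scale (q (n + 1) * (c n + c (n + 1)) + p (n + 1) * (d n + d (n + 1))) (e (n + 1))
      + scale (2 * (p (n + 1) * q (n + 1) + p n * q n + c n * d n)) (e n)
      + scale (q n * (c n + c (n - 1)) + p n * (d n + d (n - 1))) (e (n - 1))
      + scale (p n * q (n - 1) + q n * p (n - 1)) (e (n - 2))"
proof -
  interpret A: Vector_Spaces.linear scale scale A by (rule linA)
  interpret B: Vector_Spaces.linear scale scale B by (rule linB)
  have AB: "A (B (e n)) =
      scale (q (n + 1) * p (n + 2)) (e (n + 2)) + scale (q (n + 1) * c (n + 1)) (e (n + 1))
      + scale (q (n + 1) * p (n + 1)) (e n)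
      + (scale (d n * p (n + 1)) (e (n + 1)) + scale (d n * c n) (e n) + scale (d n * p n) (e (n - 1)))
      + (scale (q n * p n) (e n) + scale (q n * c (n - 1)) (e (n - 1)) + scale (q n * p (n - 1)) (e (n - 2)))"
    by (cases n) (simp_all add: A B A.add A.scale scale_right_distrib q0)
  have BA: "B (A (e n)) =
      scale (p (n + 1) * q (n + 2)) (e (n + 2)) + scale (p (n + 1) * d (n + 1)) (e (n + 1))
      + scale (p (n + 1) * q (n + 1)) (e n)
      + (scale (c n * q (n + 1)) (e (n + 1)) + scale (c n * d n) (e n) + scale (c n * q n) (e (n - 1)))
      + (scale (p n * q n) (e n) + scale (p n * d (n - 1)) (e (n - 1)) + scale (p n * q (n - 1)) (e (n - 2)))"
    by (cases n) (simp_all add: A B B.add B.scale scale_right_distrib p0)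
  show ?thesis
    unfolding anticommutator_def AB BA mult_2
    by (simp only: scale_left_distrib distrib_left ac_simps)
qed

lemma (in vector_space) linear_anticommutator:
  assumes linA: "Vector_Spaces.linear scale scale A"
    and linB: "Vector_Spaces.linear scale scale B"
  shows "Vector_Spaces.linear scale scale (anticommutator A B)"
proof -
  interpret A: Vector_Spaces.linear scale scale A by (rule linA)
  interpret B: Vector_Spaces.linear scale scale B by (rule linB)
  show ?thesis
    by unfold_locales
      (simp_all add: anticommutator_def A.add B.add A.scale B.scale scale_right_distrib add_ac)
qed

lemma (in vector_space) linear_diff_scale:
  fixes T :: "'b \<Rightarrow> 'b"
  assumes lin: "Vector_Spaces.linear scale scale T"
  shows "Vector_Spaces.linear scale scale (\<lambda>v. T v - scale s v)"
proof -
  interpret T: Vector_Spaces.linear scale scale T by (rule lin)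
  show ?thesis
    by unfold_locales
      (simp_all add: T.add T.scale scale_right_distrib scale_right_diff_distrib mult.commute)
qed

lemma (in vector_space) linear_eq_on_basis:
  assumes "Vector_Spaces.linear scale scale S" and "Vector_Spaces.linear scale scale T"
    and "\<And>n. S (e n) = T (e n)" and "span (range e) = UNIV"
  shows "S v = T v"
proof -
  interpret vector_space_pair scale scale ..
  show ?thesis
    by (rule linear_eq_on_span[of S T "range e"]) (use assms in auto)
qed

text \<open>An independent set inside the span of a finite set is finite, but injectivity makes
  \<open>range e\<close> infinite.\<close>

lemma infinite_dimensional_sequence_basis:
  fixes sc :: "complex \<Rightarrow> 'v::ab_group_add \<Rightarrow> 'v"
  assumes vs: "vector_space sc" and basis: "is_sequence_basis sc e"
  shows "infinite_dimensional sc"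
proof -
  interpret V: vector_space sc by (rule vs)
  have "infinite (range e)"
    using basis finite_imageD unfolding is_sequence_basis_def by blast
  then show ?thesis
    using basis V.independent_span_bound[of _ "range e"]
    unfolding infinite_dimensional_def is_sequence_basis_def by blast
qed

section \<open>Hermitian forms and self-adjointness\<close>

context hermitian_inner_product
begin

lemma ip_zero_left: "ip 0 z = 0"
  using ip_scale_left[of 0 0 z] by simp

lemma ip_add_right: "ip z (x + y) = ip z x + ip z y"
  by (metis complex_cnj_add ip_add_left ip_cnj)

lemma ip_scale_right: "ip z (scale r x) = cnj r * ip z x"
  by (metis complex_cnj_mult ip_scale_left ip_cnj)

lemma ip_diff_left: "ip (x - y) z = ip x z - ip y z"
  by (metis add_diff_cancel_right' diff_add_cancel ip_add_left)

lemma ip_diff_right: "ip z (x - y) = ip z x - ip z y"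
  by (metis add_diff_cancel_right' diff_add_cancel ip_add_right)

text \<open>\<open>ext\<close> extends the identity in the first argument only; conjugate symmetry
  then swaps the arguments, so a second use of \<open>ext\<close> covers the other one.\<close>

lemma self_adjointI_basis:
  assumes lin: "Vector_Spaces.linear scale scale A" and span: "span (range e) = UNIV"
    and basis: "\<And>m n. ip (A (e m)) (e n) = ip (e m) (A (e n))"
  shows "self_adjoint ip A"
proof -
  interpret A: Vector_Spaces.linear scale scale A by (rule lin)
  have ext: "ip (A v) w = ip v (A w)" if "\<And>m. ip (A (e m)) w = ip (e m) (A w)" for v w
  proof -
    have "v \<in> span (range e)" by (simp add: span)
    then show ?thesis
      by (induction rule: span_induct_alt)
        (use that in \<open>auto simp: A.add A.scale ip_add_left ip_scale_left ip_zero_left\<close>)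
  qed
  have "ip (A v) (e n) = ip v (A (e n))" for v n
    by (rule ext) (rule basis)
  then have "ip (A (e n)) v = ip (e n) (A v)" for v n
    by (metis ip_cnj)
  then show ?thesis unfolding self_adjoint_def using ext by blast
qed

text \<open>The two products are adjoint to each other, so their sum is self-adjoint; the shift
  keeps this because \<open>t\<close> is real.\<close>

lemma self_adjoint_anticommutator_diff:
  assumes A: "self_adjoint ip A" and B: "self_adjoint ip B"
  shows "self_adjoint ip (\<lambda>v. anticommutator A B v - scale (of_real t) v)"
  using A B unfolding self_adjoint_def anticommutator_def
  by (simp add: ip_add_left ip_add_right ip_diff_left ip_diff_right ip_scale_left ip_scale_right)

end

section \<open>Scalar identities for the matrix entries\<close>

locale noncompact_bannai_ito_parameters =
  fixes \<alpha> \<beta> \<gamma> \<delta> :: real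
  assumes pos: "\<alpha> > 0" "\<gamma> > 0"
begin

definition x :: "nat \<Rightarrow> real" where
  "x n = real n + 2 * \<alpha> + 2 * \<gamma> + 1"

definition sgn_pow :: "nat \<Rightarrow> real" where
  "sgn_pow n = (-1) ^ n"

definition lam :: "nat \<Rightarrow> real" where
  "lam n = sgn_pow n * (x n + 1 / 2)"

definition t1 :: real where
  "t1 = - (8 * (\<alpha> * \<gamma> - \<beta> * \<delta>) + 2 * \<alpha> + 2 * \<gamma> + 1 / 2)"

definition t2 :: real where
  "t2 = 8 * (\<alpha> * \<beta> + \<gamma> * \<delta>) + 2 * (\<beta> + \<delta>)"

definition t3 :: real where
  "t3 = 8 * (\<alpha> * \<delta> + \<beta> * \<gamma>) + 2 * (\<beta> + \<delta>)"

abbreviation c :: "nat \<Rightarrow> real" where "c \<equiv> coeff_c \<alpha> \<beta> \<gamma> \<delta>"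
abbreviation u :: "nat \<Rightarrow> real" where "u \<equiv> coeff_u \<alpha> \<beta> \<gamma> \<delta>"

definition d :: "nat \<Rightarrow> real" where
  "d n = 2 * lam n * c n - t3"

text \<open>The last two parameters are conjugate to the first two, so sums over the pairs are real
  and differences imaginary; hence all three constants are real.\<close>

lemma struct_eq:
  "struct1 (Complex \<alpha> \<beta>) (Complex \<gamma> \<delta>) (Complex \<alpha> (- \<beta>)) (Complex \<gamma> (- \<delta>)) = of_real t1"
  "struct2 (Complex \<alpha> \<beta>) (Complex \<gamma> \<delta>) (Complex \<alpha> (- \<beta>)) (Complex \<gamma> (- \<delta>)) = of_real t2"
  "struct3 (Complex \<alpha> \<beta>) (Complex \<gamma> \<delta>) (Complex \<alpha> (- \<beta>)) (Complex \<gamma> (- \<delta>)) = of_real t3"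
  unfolding struct1_def struct2_def struct3_def t1_def t2_def t3_def
  by (simp_all add: complex_eq_iff power2_eq_square algebra_simps)

lemma x_pos: "x n > 0"
  using pos by (simp add: x_def)

lemma x_Suc: "x (Suc n) = x n + 1"
  by (simp add: x_def)

lemma sgn_pow_Suc: "sgn_pow (Suc n) = - sgn_pow n"
  by (simp add: sgn_pow_def)

lemma sgn_pow_cases: obtains "even n" "sgn_pow n = 1" | "odd n" "sgn_pow n = -1"
  by (cases "even n") (auto simp: sgn_pow_def)

lemma lam_Suc: "lam n + lam (Suc n) = sgn_pow (Suc n)"
  by (simp add: lam_def x_Suc sgn_pow_Suc algebra_simps)

text \<open>The signs alternate, but the absolute value \<open>x k + 1 / 2\<close> already
  determines \<open>k\<close>.\<close>

lemma inj_lam: "inj lam"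
proof (rule injI)
  fix m n assume eq: "lam m = lam n"
  have "\<bar>lam k\<bar> = x k + 1 / 2" for k
    using x_pos[of k] by (cases rule: sgn_pow_cases[of k]) (auto simp: lam_def)
  then have "x m = x n" using eq by (metis add_right_cancel)
  then show "m = n" by (simp add: x_def)
qed

text \<open>The closed form of \<open>c n\<close>, cleared of its denominator
  \<open>4 * (lam n)^2 - 1 = 4 * x n * (x n + 1)\<close>.\<close>

lemma coeff_c_eq: "4 * x n * (x n + 1) * c n = t2 + 2 * lam n * t3"
proof -
  define X where "X = x n"
  have nz: "X \<noteq> 0" "X + 1 \<noteq> 0" using x_pos[of n] by (auto simp: X_def)
  have n: "real n = X - 2 * \<alpha> - 2 * \<gamma> - 1" by (simp add: X_def x_def)
  have clear: "X * (X + 1) * (r - y / (X + 1) - z / X) = X * (X + 1) * r - X * y - (X + 1) * z" for r y z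
  proof -
    have *: "(X + 1) * (y / (X + 1)) = y" "X * (z / X) = z" using nz by simp_all
    \<comment> \<open>The quotients become free variables, which makes the identity
      polynomial.\<close>
    have "X * (X + 1) * (r - y' - z') = X * (X + 1) * r - X * ((X + 1) * y') - (X + 1) * (X * z')" for y' z'
      by algebra
    from this[of "y / (X + 1)" "z / X"] show ?thesis unfolding * .
  qed
  show ?thesis
  proof (cases rule: sgn_pow_cases[of n])
    case 1
    have c: "c n = 2 * \<beta> - (X + 2 * \<alpha> - 2 * \<gamma> + 1) * (\<beta> - \<delta>) / (X + 1)
        - (X - 2 * \<alpha> - 2 * \<gamma> - 1) * (\<beta> + \<delta>) / X"
      unfolding coeff_c_def n using 1 by (simp add: algebra_simps)
    have "4 * x n * (x n + 1) * c n = 4 * (X * (X + 1) * c n)" by (simp add: X_def)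
    also have "\<dots> = t2 + 2 * lam n * t3"
      unfolding c clear lam_def X_def[symmetric] t2_def t3_def 1(2) by algebra
    finally show ?thesis .
  next
    case 2
    have c: "c n = 2 * \<beta> - (X + 2 * \<alpha> + 2 * \<gamma> + 2) * (\<beta> + \<delta>) / (X + 1)
        - (X - 2 * \<alpha> + 2 * \<gamma>) * (\<beta> - \<delta>) / X"
      unfolding coeff_c_def n using 2 by (simp add: algebra_simps)
    have "4 * x n * (x n + 1) * c n = 4 * (X * (X + 1) * c n)" by (simp add: X_def)
    also have "\<dots> = t2 + 2 * lam n * t3"
      unfolding c clear lam_def X_def[symmetric] t2_def t3_def 2(2) by algebra
    finally show ?thesis .
  qed
qed

text \<open>The diagonal entries of \<open>{A\<^sub>3, A\<^sub>1} = A\<^sub>2 + \<alpha>\<^sub>2\<close>.\<close>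
lemma diagonal_rel31: "2 * lam n * d n = c n + t2"
proof -
  have "4 * (lam n)\<^sup>2 = 4 * x n * (x n + 1) + 1"
    by (cases rule: sgn_pow_cases[of n]) (simp_all add: lam_def power2_eq_square algebra_simps)
  then show ?thesis using coeff_c_eq[of n] unfolding d_def by algebra
qed

lemma sgn_pow_sq: "sgn_pow n * sgn_pow n = 1"
  by (simp add: sgn_pow_def flip: power_add)

text \<open>Partial fractions: \<open>c n\<close> and \<open>d n\<close> have poles at
  \<open>x n = 0\<close> and \<open>x n = -1\<close>, and each combination keeps only one of
  them.\<close>

lemma offdiagonal_entries:
  "2 * (x n + 1) * (d n - sgn_pow n * c n) = sgn_pow n * t2 - t3"
  "2 * x n * (d n + sgn_pow n * c n) = sgn_pow n * t2 + t3"
proof -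
  have d: "d n = 2 * sgn_pow n * (x n + 1 / 2) * c n - t3" by (simp add: d_def lam_def)
  have c: "4 * x n * (x n + 1) * c n = t2 + 2 * sgn_pow n * (x n + 1 / 2) * t3"
    using coeff_c_eq[of n] by (simp add: lam_def)
  have "x n * (2 * (x n + 1) * (d n - sgn_pow n * c n)) = x n * (sgn_pow n * t2 - t3)"
    using c sgn_pow_sq[of n] unfolding d by algebra
  then show "2 * (x n + 1) * (d n - sgn_pow n * c n) = sgn_pow n * t2 - t3"
    using x_pos[of n] by simp
  have "(x n + 1) * (2 * x n * (d n + sgn_pow n * c n)) = (x n + 1) * (sgn_pow n * t2 + t3)"
    using c sgn_pow_sq[of n] unfolding d by algebra
  then show "2 * x n * (d n + sgn_pow n * c n) = sgn_pow n * t2 + t3"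
    using x_pos[of n] by simp
qed

text \<open>The subdiagonal entries of \<open>{A\<^sub>2, A\<^sub>3} = - A\<^sub>1 + \<alpha>\<^sub>1\<close>.\<close>
lemma offdiagonal_rel23: "sgn_pow (Suc n) * (c n + c (Suc n)) + (d n + d (Suc n)) = 0"
proof -
  \<comment> \<open>The terms at \<open>n\<close> and at \<open>Suc n\<close> share the denominator
    \<open>x n + 1 = x (Suc n)\<close> and have opposite numerators.\<close>
  have "2 * (x n + 1) * (sgn_pow (Suc n) * (c n + c (Suc n)) + (d n + d (Suc n))) = 0"
    using offdiagonal_entries(1)[of n] offdiagonal_entries(2)[of "Suc n"]
    unfolding x_Suc sgn_pow_Suc by algebra
  then show ?thesis using x_pos[of n] by simp
qed

definition K :: "nat \<Rightarrow> real" where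
  "K n = (if even n then 4 * (\<beta> + \<delta>)\<^sup>2 - (2 * \<alpha> + 2 * \<gamma> + 1)\<^sup>2 else 4 * (\<beta> - \<delta>)\<^sup>2 - 4 * (\<alpha> - \<gamma>)\<^sup>2)"

text \<open>The left side factors as \<open>4 (X^2 - r^2) (X^2 + s^2)\<close>, with
  \<open>r = 2\<alpha> + 2\<gamma> + 1\<close>, \<open>s = 2(\<beta> + \<delta>)\<close> for even
  \<open>n\<close> and \<open>r = 2(\<alpha> - \<gamma>)\<close>,
  \<open>s = 2(\<beta> - \<delta>)\<close> for odd \<open>n\<close>. Then
  \<open>K n = s^2 - r^2\<close> and \<open>t2 + sgn_pow n * t3 = 2 r s\<close>.\<close>

lemma coeff_u_eq: "16 * (x n)\<^sup>2 * u n = 4 * (x n)\<^sup>2 * ((x n)\<^sup>2 + K n) - (t2 + sgn_pow n * t3)\<^sup>2"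
proof -
  define X where "X = x n"
  have nz: "X \<noteq> 0" using x_pos[of n] by (auto simp: X_def)
  have n: "real n = X - 2 * \<alpha> - 2 * \<gamma> - 1" by (simp add: X_def x_def)
  have cmod: "(cmod (of_nat n + 2 * (of_real (\<alpha> + \<gamma>) + \<i> * of_real z) + 1))\<^sup>2 = X\<^sup>2 + 4 * z\<^sup>2" for z
    unfolding cmod_power2 by (simp add: n algebra_simps power2_eq_square)
  have clear: "16 * X\<^sup>2 * (y / (4 * X\<^sup>2)) = 4 * y" for y
    using nz by simp
  show ?thesis
  proof (cases rule: sgn_pow_cases[of n])
    case 1
    have u: "u n = (X - 2 * \<alpha> - 2 * \<gamma> - 1) * (X + 2 * \<alpha> + 2 * \<gamma> + 1)
        * (X\<^sup>2 + 4 * (\<beta> + \<delta>)\<^sup>2) / (4 * X\<^sup>2)"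
      unfolding coeff_u_def cmod n using 1 by (simp add: algebra_simps)
    have K: "K n = 4 * (\<beta> + \<delta>)\<^sup>2 - (2 * \<alpha> + 2 * \<gamma> + 1)\<^sup>2" using 1 by (simp add: K_def)
    show ?thesis
      unfolding X_def[symmetric] u clear K t2_def t3_def 1(2) by algebra
  next
    case 2
    have u: "u n = (X + 2 * \<alpha> - 2 * \<gamma>) * (X - 2 * \<alpha> + 2 * \<gamma>)
        * (X\<^sup>2 + 4 * (\<beta> - \<delta>)\<^sup>2) / (4 * X\<^sup>2)"
      unfolding coeff_u_def cmod n using 2 by (simp add: algebra_simps)
    have K: "K n = 4 * (\<beta> - \<delta>)\<^sup>2 - 4 * (\<alpha> - \<gamma>)\<^sup>2" using 2 by (simp add: K_def)
    show ?thesis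
      unfolding X_def[symmetric] u clear K t2_def t3_def 2(2) by algebra
  qed
qed

text \<open>This jump between the two parity values is how \<open>t1\<close> enters the diagonal of
  the second relation.\<close>

lemma K_Suc: "K (Suc n) = K n - 2 * sgn_pow n * t1"
  by (cases rule: sgn_pow_cases[of n])
    (simp_all add: K_def t1_def power2_eq_square algebra_simps)

text \<open>The diagonal entries of \<open>{A\<^sub>2, A\<^sub>3} = - A\<^sub>1 + \<alpha>\<^sub>1\<close>.\<close>
lemma diagonal_rel23:
  "2 * (sgn_pow (Suc n) * u (Suc n) + sgn_pow n * u n + c n * d n) = - lam n + t1"
proof -
  define X where "X = x n"
  define w where "w = sgn_pow n"
  have ww: "w * w = 1" by (simp add: w_def sgn_pow_sq)
  have nz: "X \<noteq> 0" "X + 1 \<noteq> 0" using x_pos[of n] by (auto simp: X_def)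
  have u: "16 * X\<^sup>2 * u n = 4 * X\<^sup>2 * (X\<^sup>2 + K n) - (t2 + w * t3)\<^sup>2"
    using coeff_u_eq[of n] by (simp add: X_def w_def)
  have u': "16 * (X + 1)\<^sup>2 * u (Suc n)
      = 4 * (X + 1)\<^sup>2 * ((X + 1)\<^sup>2 + K n - 2 * w * t1) - (t2 - w * t3)\<^sup>2"
    using coeff_u_eq[of "Suc n"] unfolding X_def x_Suc K_Suc sgn_pow_Suc w_def by simp
  have lam: "lam n = w * (X + 1 / 2)" by (simp add: lam_def X_def w_def)
  have c: "4 * X * (X + 1) * c n = t2 + w * (2 * X + 1) * t3"
    using coeff_c_eq[of n] unfolding lam X_def[symmetric] by algebra
  have d: "d n = w * (2 * X + 1) * c n - t3" unfolding d_def lam by algebra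
  have "16 * X\<^sup>2 * (X + 1)\<^sup>2 * (2 * (- w * u (Suc n) + w * u n + c n * d n))
      = 16 * X\<^sup>2 * (X + 1)\<^sup>2 * (- lam n + t1)"
  proof -
    have cd: "16 * X\<^sup>2 * (X + 1)\<^sup>2 * (c n * d n)
       = (t2 + w * (2 * X + 1) * t3) * (w * (2 * X + 1) * (t2 + w * (2 * X + 1) * t3) - 4 * X * (X + 1) * t3)"
      unfolding d c[symmetric] by algebra
    \<comment> \<open>Regrouped so that the left sides of \<open>u\<close>, \<open>u'\<close> and
      \<open>cd\<close> occur literally; what remains is polynomial modulo
      \<open>w * w = 1\<close>.\<close>
    have "16 * X\<^sup>2 * (X + 1)\<^sup>2 * (2 * (- w * u (Suc n) + w * u n + c n * d n))
      = - 2 * w * X\<^sup>2 * (16 * (X + 1)\<^sup>2 * u (Suc n)) + 2 * w * (X + 1)\<^sup>2 * (16 * X\<^sup>2 * u n)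
        + 2 * (16 * X\<^sup>2 * (X + 1)\<^sup>2 * (c n * d n))" by algebra
    also have "\<dots> = 16 * X\<^sup>2 * (X + 1)\<^sup>2 * (- lam n + t1)"
      unfolding u u' cd lam using ww by algebra
    finally show ?thesis .
  qed
  then show ?thesis using nz by (simp add: w_def sgn_pow_Suc)
qed

lemma coeff_u_0: "u 0 = 0"
  by (simp add: coeff_u_def)

text \<open>The complex factor has positive real part, so its modulus cannot vanish. Positivity lets
  the square roots square back to \<open>u n\<close> and links neighbouring basis vectors.\<close>

lemma coeff_u_pos:
  assumes "n > 0" shows "u n > 0"
proof -
  have "cmod (of_nat n + 2 * (of_real (\<alpha> + \<gamma>) + \<i> * of_real z) + 1) > 0" for z
  proof -
    have "Re (of_nat n + 2 * (of_real (\<alpha> + \<gamma>) + \<i> * of_real z) + 1) > 0"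
      using pos by (simp add: add_pos_pos)
    then show ?thesis by (metis zero_complex.simps(1) less_irrefl zero_less_norm_iff)
  qed
  then have sq: "(cmod (of_nat n + 2 * (of_real (\<alpha> + \<gamma>) + \<i> * of_real z) + 1))\<^sup>2 > 0" for z
    by (metis zero_less_power)
  have x: "4 * (real n + 2 * \<alpha> + 2 * \<gamma> + 1)\<^sup>2 > 0"
    using x_pos[of n] by (simp add: x_def)
  have "real n > 0" using assms by simp
  then have "real n * (real n + 4 * \<alpha> + 4 * \<gamma> + 2) > 0" "(real n + 4 * \<alpha> + 1) * (real n + 4 * \<gamma> + 1) > 0"
    using pos by (auto intro!: mult_pos_pos)
  then show ?thesis
    unfolding coeff_u_def by (auto simp only: split: if_split intro!: divide_pos_pos mult_pos_pos sq x)
qed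

end

theorem proposition4:
  fixes \<alpha> \<beta> \<gamma> \<delta> :: real
    and scale :: "complex \<Rightarrow> 'v::ab_group_add \<Rightarrow> 'v"
    and e :: "nat \<Rightarrow> 'v"
    and ip :: "'v \<Rightarrow> 'v \<Rightarrow> complex"
    and A1 A2 A3 :: "'v \<Rightarrow> 'v"
    and a b c d s1 s2 s3 :: complex
  assumes pos: "\<alpha> > 0" "\<beta> > 0" "\<gamma> > 0" "\<delta> > 0"
    and vs: "vector_space scale"
    and basis: "is_sequence_basis scale e"
    and inner: "hermitian_inner_product scale ip"
    and orthonormal: "orthonormal ip e"
    and params: "a = Complex \<alpha> \<beta>" "b = Complex \<gamma> \<delta>" "c = Complex \<alpha> (- \<beta>)" "d = Complex \<gamma> (- \<delta>)"
    and structure_constants: "s1 = struct1 a b c d" "s2 = struct2 a b c d" "s3 = struct3 a b c d"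
    and linear_A1: "Vector_Spaces.linear scale scale A1"
    and A1: "\<And>n. A1 (e n) =
          scale (of_real ((-1) ^ n * (real n + 2 * \<alpha> + 2 * \<gamma> + 3 / 2))) (e n)"
    and linear_A2: "Vector_Spaces.linear scale scale A2"
    and A2: "\<And>n. A2 (e n) =
          scale (of_real (sqrt (coeff_u \<alpha> \<beta> \<gamma> \<delta> (n + 1)))) (e (n + 1))
          + scale (of_real (coeff_c \<alpha> \<beta> \<gamma> \<delta> n)) (e n)
          + (if n = 0 then 0
             else scale (of_real (sqrt (coeff_u \<alpha> \<beta> \<gamma> \<delta> n))) (e (n - 1)))"
    and A3: "\<And>v. A3 v = anticommutator A1 A2 v - scale s3 v"
  shows "infinite_dimensional scale
       \<and> noncompact_bannai_ito_rep scale s1 s2 s3 A1 A2 A3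
       \<and> irreducible_rep scale A1 A2 A3
       \<and> self_adjoint ip A1 \<and> self_adjoint ip A2 \<and> self_adjoint ip A3"
proof -
  interpret V: vector_space scale by (rule vs)
  interpret VP: vector_space_pair scale scale ..
  interpret H: hermitian_inner_product scale ip by (rule inner)
  interpret P: noncompact_bannai_ito_parameters \<alpha> \<beta> \<gamma> \<delta> by unfold_locales (use pos in auto)
  interpret A1: Vector_Spaces.linear scale scale A1 by (rule linear_A1)
  interpret A2: Vector_Spaces.linear scale scale A2 by (rule linear_A2)
  note struct = structure_constants[unfolded params P.struct_eq]
  have span: "V.span (range e) = UNIV" using basis by (simp add: is_sequence_basis_def)

  \<comment> \<open>Matrix entries in the basis\<close>
  define p where "p n = sqrt (P.u n)" for n
  define q where "q n = P.sgn_pow n * p n" for n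
  have p0: "p 0 = 0" and q0: "q 0 = 0" by (simp_all add: p_def q_def P.coeff_u_0)
  have pos_p: "p n > 0" if "n > 0" for n
    using P.coeff_u_pos[OF that] by (simp add: p_def)
  have p_sq: "p n * p n = P.u n" for n
    using P.coeff_u_pos[of n] P.coeff_u_0 by (cases "n = 0") (simp_all add: p_def)
  have A1_e: "A1 (e n) = scale (of_real (P.lam n)) (e n)" for n
    unfolding A1 P.lam_def P.sgn_pow_def P.x_def by (simp add: algebra_simps)
  have A2_e: "A2 (e n) = scale (of_real (p (n + 1))) (e (n + 1)) + scale (of_real (P.c n)) (e n)
      + scale (of_real (p n)) (e (n - 1))" for n
    unfolding A2 p_def by (simp add: P.coeff_u_0)
  have A3_fun: "A3 = (\<lambda>v. anticommutator A1 A2 v - scale (of_real P.t3) v)"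
    using A3 struct by auto
  have linear_A3: "Vector_Spaces.linear scale scale A3"
    unfolding A3_fun by (intro V.linear_diff_scale V.linear_anticommutator linear_A1 linear_A2)
  \<comment> \<open>The diagonal operator in tridiagonal shape, as
    \<open>anticommutator_tridiagonal\<close> expects.\<close>
  have A1_e': "A1 (e n) = scale 0 (e (n + 1)) + scale (of_real (P.lam n)) (e n) + scale 0 (e (n - 1))" for n
    by (simp add: A1_e)
  have lam_pred: "p n * (P.lam n + P.lam (n - 1)) = q n" for n
    by (cases n) (simp_all add: p0 q0 q_def P.lam_Suc add.commute)
  have A3_e: "A3 (e n) = scale (of_real (q (n + 1))) (e (n + 1)) + scale (of_real (P.d n)) (e n)
      + scale (of_real (q n)) (e (n - 1))" for n
  proof -
    have up: "p (n + 1) * (P.lam n + P.lam (n + 1)) = q (n + 1)"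
      by (simp add: q_def P.lam_Suc)
    have "anticommutator A1 A2 (e n) = scale (of_real (p (n + 1) * (P.lam n + P.lam (n + 1)))) (e (n + 1))
        + scale (of_real (2 * (P.lam n * P.c n))) (e n)
        + scale (of_real (p n * (P.lam n + P.lam (n - 1)))) (e (n - 1))"
      by (subst V.anticommutator_tridiagonal[OF linear_A1 linear_A2 A1_e' A2_e]) (simp_all add: p0)
    then show ?thesis
      unfolding A3_fun up lam_pred P.d_def
      by (simp add: V.scale_left_diff_distrib)
  qed

  \<comment> \<open>The defining relations\<close>
  have rel12: "anticommutator A1 A2 v = A3 v + scale s3 v" for v
    using A3 by simp
  \<comment> \<open>With the scalar moved to the left, both sides are linear operators and may be
    compared on the basis.\<close>
  have "anticommutator A3 A1 (e n) - scale s2 (e n) = A2 (e n)" for n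
  proof -
    have up: "q (n + 1) * (P.lam n + P.lam (n + 1)) = p (n + 1)"
      by (simp add: q_def P.lam_Suc P.sgn_pow_sq)
    have down: "q n * (P.lam n + P.lam (n - 1)) = p n"
      by (cases n) (simp_all add: p0 q0 q_def P.lam_Suc P.sgn_pow_sq add.commute)
    have diag: "2 * (P.d n * P.lam n) = P.c n + P.t2"
      using P.diagonal_rel31[of n] by (simp add: mult_ac)
    have "anticommutator A3 A1 (e n) = scale (of_real (q (n + 1) * (P.lam n + P.lam (n + 1)))) (e (n + 1))
        + scale (of_real (2 * (P.d n * P.lam n))) (e n)
        + scale (of_real (q n * (P.lam n + P.lam (n - 1)))) (e (n - 1))"
      by (subst V.anticommutator_tridiagonal[OF linear_A3 linear_A1 A3_e A1_e']) (simp_all add: q0)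
    then show ?thesis
      unfolding up down diag A2_e struct by (simp add: V.scale_left_distrib)
  qed
  then have "anticommutator A3 A1 v - scale s2 v = A2 v" for v
    by (rule V.linear_eq_on_basis[OF V.linear_diff_scale[OF V.linear_anticommutator[OF linear_A3 linear_A1]]
          linear_A2 _ span])
  then have rel31: "anticommutator A3 A1 v = A2 v + scale s2 v" for v
    by (metis diff_add_cancel)

  have "anticommutator A2 A3 (e n) - scale s1 (e n) = - A1 (e n)" for n
  proof -
    \<comment> \<open>Consecutive \<open>q\<close> carry opposite signs.\<close>
    have up2: "p (n + 2) * q (n + 1) + q (n + 2) * p (n + 1) = 0" for n
      by (simp add: q_def P.sgn_pow_Suc)
    have up: "q (n + 1) * (P.c n + P.c (n + 1)) + p (n + 1) * (P.d n + P.d (n + 1)) = 0" for n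
    proof -
      have "p (n + 1) * (P.sgn_pow (Suc n) * (P.c n + P.c (Suc n)) + (P.d n + P.d (Suc n))) = 0"
        by (simp only: P.offdiagonal_rel23 mult_zero_right)
      then show ?thesis by (simp add: q_def algebra_simps)
    qed
    have down: "q n * (P.c n + P.c (n - 1)) + p n * (P.d n + P.d (n - 1)) = 0"
      using up[of "n - 1"] by (cases n) (simp_all add: p0 q0 add.commute)
    \<comment> \<open>For \<open>n\<close> equal to 0 or 1 the index \<open>n - 1\<close> is 0, and
      \<open>p 0 = q 0 = 0\<close> applies.\<close>
    have down2: "p n * q (n - 1) + q n * p (n - 1) = 0"
      using up2[of "n - 2"] p0 q0 by (cases n rule: old.nat.exhaust; cases "n - 1") (simp_all add: add.commute)
    have diag: "2 * (p (n + 1) * q (n + 1) + p n * q n + P.c n * P.d n) = - P.lam n + P.t1"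
      using P.diagonal_rel23[of n] by (simp add: q_def p_sq[symmetric] algebra_simps)
    have "anticommutator A2 A3 (e n) =
        scale (of_real (p (n + 2) * q (n + 1) + q (n + 2) * p (n + 1))) (e (n + 2))
        + scale (of_real (q (n + 1) * (P.c n + P.c (n + 1)) + p (n + 1) * (P.d n + P.d (n + 1)))) (e (n + 1))
        + scale (of_real (2 * (p (n + 1) * q (n + 1) + p n * q n + P.c n * P.d n))) (e n)
        + scale (of_real (q n * (P.c n + P.c (n - 1)) + p n * (P.d n + P.d (n - 1)))) (e (n - 1))
        + scale (of_real (p n * q (n - 1) + q n * p (n - 1))) (e (n - 2))"
      by (subst V.anticommutator_tridiagonal[OF linear_A2 linear_A3 A2_e A3_e]) (simp_all add: p0 q0)
    then show ?thesis
      unfolding up2 up down down2 diag A1_e struct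
      by (simp add: V.scale_left_distrib V.scale_left_diff_distrib)
  qed
  then have "anticommutator A2 A3 v - scale s1 v = - A1 v" for v
    by (rule V.linear_eq_on_basis[OF V.linear_diff_scale[OF V.linear_anticommutator[OF linear_A2 linear_A3]]
          VP.linear_compose_neg[OF linear_A1] _ span])
  then have rel23: "anticommutator A2 A3 v = - A1 v + scale s1 v" for v
    by (simp add: diff_eq_eq)

  have rep: "noncompact_bannai_ito_rep scale s1 s2 s3 A1 A2 A3"
    by (intro noncompact_bannai_ito_rep.intro noncompact_bannai_ito_rep_axioms.intro vs
        linear_A1 linear_A2 linear_A3 rel12 rel23 rel31)

  \<comment> \<open>Irreducibility\<close>
  have irreducible: "W = {0} \<or> W = UNIV"
    if W: "V.subspace W" "invariant_under A1 W" "invariant_under A2 W" for W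
  proof (cases "W = {0}")
    case False
    then obtain w where w: "w \<in> W" "w \<noteq> 0" using V.subspace_0[OF W(1)] by auto
    have comp: "scale (r k) (e k) \<in> W"
      if "finite S" "(\<Sum>k\<in>S. scale (r k) (e k)) \<in> W" "k \<in> S" for S r k
      using V.eigencomponents_mem_invariant_subspace[OF linear_A1 W(1,2), of S
          "\<lambda>n. of_real (P.lam n)" "\<lambda>k. scale (r k) (e k)"] that P.inj_lam
      by (simp add: A1.scale A1_e inj_on_def inj_def mult.commute)
    have unscale: "v \<in> W" if "scale r v \<in> W" "r \<noteq> 0" for r v
      using V.subspace_scale[OF W(1) that(1), of "inverse r"] that(2) by simp
    have "inj e" using basis by (simp add: is_sequence_basis_def)
    have "w \<in> V.span (range e)" by (simp add: span)
    then obtain S' r where S': "finite S'" "S' \<subseteq> range e" "w = (\<Sum>v\<in>S'. scale (r v) v)"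
      unfolding V.span_explicit by blast
    obtain S where S: "finite S" "S' = e ` S"
      using S'(1,2) by (metis finite_subset_image)
    have w_sum: "w = (\<Sum>k\<in>S. scale (r (e k)) (e k))"
      unfolding S'(3) S(2) using \<open>inj e\<close> by (simp add: sum.reindex inj_on_subset)
    then obtain k where k: "k \<in> S" "r (e k) \<noteq> 0"
      using w(2) by (metis (no_types, lifting) V.scale_zero_left sum.neutral)
    have "e k \<in> W"
      using unscale[OF comp[OF S(1) _ k(1), of "\<lambda>k. r (e k)"] k(2)] w(1) w_sum by simp
    have neighbours: "e (n + 1) \<in> W \<and> (n > 0 \<longrightarrow> e (n - 1) \<in> W)" if "e n \<in> W" for n
    proof -
      define r :: "nat \<Rightarrow> complex" where
        "r k = (if k = n + 1 then of_real (p (n + 1)) else if k = n then of_real (P.c n) else of_real (p n))" for k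
      \<comment> \<open>The support of \<open>A2 (e n)\<close>; at \<open>n = 0\<close> the
        truncated \<open>n - 1\<close> would coincide with \<open>n\<close>.\<close>
      define S where "S = (if n = 0 then {n + 1, n} else {n + 1, n, n - 1})"
      have "A2 (e n) = (\<Sum>k\<in>S. scale (r k) (e k))"
        by (cases n) (simp_all add: A2_e S_def r_def p0 add.assoc)
      moreover have "A2 (e n) \<in> W" using W(3) that by (simp add: invariant_under_def)
      ultimately have "scale (r k) (e k) \<in> W" if "k \<in> S" for k
        using comp[OF _ _ that, of r] by (simp add: S_def)
      moreover have "r (n + 1) \<noteq> 0" "n > 0 \<Longrightarrow> r (n - 1) \<noteq> 0"
        using pos_p[of "n + 1"] pos_p[of n] by (auto simp: r_def)
      moreover have "n + 1 \<in> S" "n > 0 \<Longrightarrow> n - 1 \<in> S" by (auto simp: S_def)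
      ultimately show ?thesis using unscale by blast
    qed
    \<comment> \<open>Descend from \<open>e k\<close> to \<open>e 0\<close>, where truncated
      subtraction stops, and then climb to every \<open>e n\<close>.\<close>
    have "e (k - j) \<in> W" for j
    proof (induction j)
      case 0
      then show ?case using \<open>e k \<in> W\<close> by simp
    next
      case (Suc j)
      then show ?case using neighbours[of "k - j"] by (cases "k - j > 0") (simp_all add: Suc_diff_Suc)
    qed
    from this[of k] have "e 0 \<in> W" by simp
    then have "e n \<in> W" for n by (induction n) (use neighbours in auto)
    then have "V.span (range e) \<subseteq> W" using W(1) by (intro V.span_minimal) auto
    then show ?thesis using span by auto
  qed simp
  have "irreducible_rep scale A1 A2 A3"
    unfolding irreducible_rep_def using irreducible by blast

  \<comment> \<open>Self-adjointness of the generators\<close>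
  have sa1: "self_adjoint ip A1"
    by (rule H.self_adjointI_basis[OF linear_A1 span])
      (use orthonormal in \<open>simp add: A1_e orthonormal_def H.ip_scale_left H.ip_scale_right\<close>)
  have sa2: "self_adjoint ip A2"
  proof (rule H.self_adjointI_basis[OF linear_A2 span])
    fix m n
    show "ip (A2 (e m)) (e n) = ip (e m) (A2 (e n))"
      using orthonormal p0
      by (cases m; cases n) (auto simp: A2_e orthonormal_def H.ip_scale_left H.ip_scale_right
          H.ip_add_left H.ip_add_right)
  qed
  have "self_adjoint ip A3"
    unfolding A3_fun by (rule H.self_adjoint_anticommutator_diff[OF sa1 sa2])
  then show ?thesis
    using infinite_dimensional_sequence_basis[OF vs basis] rep \<open>irreducible_rep scale A1 A2 A3\<close> sa1 sa2
    by blast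
qed

end
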